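(* Let $k$ be a nonzero commutative unital ring. The unital associative $k$-algebra defined by generators $s_1,s_2$ and relations $s_1s_2s_1=s_2s_1s_2$, $s_1^3=s_2^3=0$ is not finitely generated as a $k$-module. *)

theory Defs
  imports Complex_Main "HOL-Library.Poly_Mapping"
begin

section \<open>The free algebra on two generators\<close>

datatype gen = S1 | S2

text \<open>
  The free monoid on the two generators, written additively as \<open>Poly_Mapping\<close> requires:
  \<open>0\<close> is the empty word and \<open>+\<close> is concatenation.
\<close>

datatype gen_word = Word (letters: "gen list")

instantiation gen_word :: monoid_add
begin

definition zero_gen_word :: gen_word where
  "zero_gen_word = Word []"

definition plus_gen_word :: "gen_word \<Rightarrow> gen_word \<Rightarrow> gen_word" where
  "plus_gen_word u v = Word (letters u @ letters v)"

instance
  by standard (simp_all add: zero_gen_word_def plus_gen_word_def)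

end

lemma gen_word_zero_eq_plus: "(0 :: gen_word) = u + v \<longleftrightarrow> u = 0 \<and> v = 0"
  by (cases u; cases v) (auto simp: zero_gen_word_def plus_gen_word_def)

text \<open>
  The free unital associative algebra is the monoid algebra of the free monoid; the
  multiplication that \<open>Poly_Mapping\<close> provides is the convolution product.
\<close>

type_synonym 'k free_alg = "gen_word \<Rightarrow>\<^sub>0 'k"

definition X1 :: "'k::comm_ring_1 free_alg" where
  "X1 = Poly_Mapping.single (Word [S1]) 1"

definition X2 :: "'k::comm_ring_1 free_alg" where
  "X2 = Poly_Mapping.single (Word [S2]) 1"


section \<open>Two-sided ideals\<close>

text \<open>Closure under negation follows from the last conditions, taking \<open>r = - 1\<close>.\<close>

definition two_sided_ideal :: "'a::ring_1 set \<Rightarrow> bool" where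
  "two_sided_ideal I \<longleftrightarrow>
     0 \<in> I \<and> (\<forall>a\<in>I. \<forall>b\<in>I. a + b \<in> I) \<and> (\<forall>a\<in>I. \<forall>r. r * a \<in> I \<and> a * r \<in> I)"

definition generated_ideal :: "'a::ring_1 set \<Rightarrow> 'a set" where
  "generated_ideal R = \<Inter>{I. two_sided_ideal I \<and> R \<subseteq> I}"

lemma two_sided_ideal_generated_ideal: "two_sided_ideal (generated_ideal R)"
  unfolding generated_ideal_def two_sided_ideal_def by blast

lemma generated_ideal_superset: "R \<subseteq> generated_ideal R"
  unfolding generated_ideal_def by blast

lemma generated_ideal_minimal:
  "two_sided_ideal I \<Longrightarrow> R \<subseteq> I \<Longrightarrow> generated_ideal R \<subseteq> I"
  unfolding generated_ideal_def by blast


section \<open>The presented algebra\<close>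

text \<open>
  The ground ring is a type \<open>'k::comm_ring_1\<close>; this class includes \<open>0 \<noteq> 1\<close>, so the ring
  is nonzero.
\<close>

definition cubic_relators :: "'k::comm_ring_1 free_alg set" where
  "cubic_relators = {X1 * X2 * X1 - X2 * X1 * X2, X1 ^ 3, X2 ^ 3}"

definition cubic_ideal :: "'k::comm_ring_1 free_alg set" where
  "cubic_ideal = generated_ideal cubic_relators"

lemma two_sided_ideal_cubic_ideal: "two_sided_ideal cubic_ideal"
  unfolding cubic_ideal_def by (rule two_sided_ideal_generated_ideal)

lemma
  shows cubic_ideal_zero: "0 \<in> cubic_ideal"
    and cubic_ideal_add: "a \<in> cubic_ideal \<Longrightarrow> b \<in> cubic_ideal \<Longrightarrow> a + b \<in> cubic_ideal"
    and cubic_ideal_lmult: "a \<in> cubic_ideal \<Longrightarrow> r * a \<in> cubic_ideal"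
    and cubic_ideal_rmult: "a \<in> cubic_ideal \<Longrightarrow> a * r \<in> cubic_ideal"
  using two_sided_ideal_cubic_ideal unfolding two_sided_ideal_def by blast+

lemma cubic_ideal_uminus: "a \<in> cubic_ideal \<Longrightarrow> - a \<in> cubic_ideal"
  using cubic_ideal_lmult[of a "- 1"] by simp

definition cubic_rel :: "'k::comm_ring_1 free_alg \<Rightarrow> 'k free_alg \<Rightarrow> bool" where
  "cubic_rel f g \<longleftrightarrow> f - g \<in> cubic_ideal"

lemma equivp_cubic_rel: "equivp (cubic_rel :: 'k::comm_ring_1 free_alg \<Rightarrow> _)"
proof (rule equivpI)
  show "reflp (cubic_rel :: 'k free_alg \<Rightarrow> _)"
    by (rule reflpI) (simp add: cubic_rel_def cubic_ideal_zero)
  show "symp (cubic_rel :: 'k free_alg \<Rightarrow> _)"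
  proof (rule sympI)
    fix f g :: "'k free_alg"
    assume "cubic_rel f g"
    then show "cubic_rel g f"
      unfolding cubic_rel_def using cubic_ideal_uminus[of "f - g"] by simp
  qed
  show "transp (cubic_rel :: 'k free_alg \<Rightarrow> _)"
  proof (rule transpI)
    fix f g h :: "'k free_alg"
    assume "cubic_rel f g" "cubic_rel g h"
    then show "cubic_rel f h"
      unfolding cubic_rel_def using cubic_ideal_add[of "f - g" "g - h"] by simp
  qed
qed

quotient_type (overloaded) 'k cubic_alg = "'k::comm_ring_1 free_alg" / cubic_rel
  by (rule equivp_cubic_rel)

lemma lookup_mult_zero:
  fixes f g :: "'k::comm_ring_1 free_alg"
  shows "Poly_Mapping.lookup (f * g) 0 = Poly_Mapping.lookup f 0 * Poly_Mapping.lookup g 0"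
proof -
  have "Sum_any (\<lambda>q. Poly_Mapping.lookup g q when (0::gen_word) = l + q) =
        (Poly_Mapping.lookup g 0 when l = 0)" for l
    by (cases "l = 0") (simp_all add: gen_word_zero_eq_plus)
  then show ?thesis
    by (simp add: lookup_mult mult_when)
qed

lemma one_notin_cubic_ideal: "(1 :: 'k::comm_ring_1 free_alg) \<notin> cubic_ideal"
proof -
  let ?I = "{f :: 'k free_alg. Poly_Mapping.lookup f 0 = 0}"
  have X: "Poly_Mapping.lookup (X1 :: 'k free_alg) 0 = 0"
          "Poly_Mapping.lookup (X2 :: 'k free_alg) 0 = 0"
    by (simp_all add: X1_def X2_def lookup_single zero_gen_word_def)
  have "two_sided_ideal ?I"
    by (simp add: two_sided_ideal_def lookup_add lookup_mult_zero)
  moreover have "cubic_relators \<subseteq> ?I"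
    by (simp add: cubic_relators_def lookup_minus lookup_mult_zero X power3_eq_cube)
  ultimately have "cubic_ideal \<subseteq> ?I"
    unfolding cubic_ideal_def by (rule generated_ideal_minimal)
  then show ?thesis
    by auto
qed

instantiation cubic_alg :: (comm_ring_1) ring_1
begin

lift_definition zero_cubic_alg :: "'a cubic_alg" is 0 .

lift_definition one_cubic_alg :: "'a cubic_alg" is 1 .

lift_definition plus_cubic_alg :: "'a cubic_alg \<Rightarrow> 'a cubic_alg \<Rightarrow> 'a cubic_alg" is "(+)"
proof -
  fix f f' g g' :: "'a free_alg"
  assume "cubic_rel f f'" "cubic_rel g g'"
  then have "(f - f') + (g - g') \<in> cubic_ideal"
    unfolding cubic_rel_def by (rule cubic_ideal_add)
  then show "cubic_rel (f + g) (f' + g')"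
    unfolding cubic_rel_def by (simp add: algebra_simps)
qed

lift_definition uminus_cubic_alg :: "'a cubic_alg \<Rightarrow> 'a cubic_alg" is uminus
proof -
  fix f f' :: "'a free_alg"
  assume "cubic_rel f f'"
  then have "- (f - f') \<in> cubic_ideal"
    unfolding cubic_rel_def by (rule cubic_ideal_uminus)
  then show "cubic_rel (- f) (- f')"
    unfolding cubic_rel_def by simp
qed

lift_definition minus_cubic_alg :: "'a cubic_alg \<Rightarrow> 'a cubic_alg \<Rightarrow> 'a cubic_alg" is "(-)"
proof -
  fix f f' g g' :: "'a free_alg"
  assume "cubic_rel f f'" "cubic_rel g g'"
  then have "(f - f') + - (g - g') \<in> cubic_ideal"
    unfolding cubic_rel_def by (intro cubic_ideal_add cubic_ideal_uminus)
  then show "cubic_rel (f - g) (f' - g')"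
    unfolding cubic_rel_def by (simp add: algebra_simps)
qed

lift_definition times_cubic_alg :: "'a cubic_alg \<Rightarrow> 'a cubic_alg \<Rightarrow> 'a cubic_alg" is "(*)"
proof -
  fix f f' g g' :: "'a free_alg"
  assume "cubic_rel f f'" "cubic_rel g g'"
  then have "(f - f') * g \<in> cubic_ideal" "f' * (g - g') \<in> cubic_ideal"
    unfolding cubic_rel_def by (simp_all add: cubic_ideal_lmult cubic_ideal_rmult)
  then have "(f - f') * g + f' * (g - g') \<in> cubic_ideal"
    by (rule cubic_ideal_add)
  then show "cubic_rel (f * g) (f' * g')"
    unfolding cubic_rel_def by (simp add: algebra_simps)
qed

instance
proof
  show "(0 :: 'a cubic_alg) \<noteq> 1"
    by transfer
       (use cubic_ideal_uminus one_notin_cubic_ideal in \<open>fastforce simp: cubic_rel_def\<close>)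
qed (transfer; simp add: cubic_rel_def cubic_ideal_zero algebra_simps)+

end

lift_definition cubic_scale :: "'k::comm_ring_1 \<Rightarrow> 'k cubic_alg \<Rightarrow> 'k cubic_alg"
  is "\<lambda>c. Poly_Mapping.map ((*) c)"
  unfolding cubic_rel_def mult_map_scale_conv_mult
  by (metis cubic_ideal_lmult right_diff_distrib)

lemma module_cubic_scale: "module (cubic_scale :: 'k::comm_ring_1 \<Rightarrow> _)"
proof (rule module.intro)
  fix a b :: 'k and x y :: "'k cubic_alg"
  show "cubic_scale a (x + y) = cubic_scale a x + cubic_scale a y"
    by transfer (simp add: cubic_rel_def mult_map_scale_conv_mult cubic_ideal_zero distrib_left)
  show "cubic_scale (a + b) x = cubic_scale a x + cubic_scale b x"
    by transfer (simp add: cubic_rel_def mult_map_scale_conv_mult cubic_ideal_zero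
        distrib_right single_add)
  show "cubic_scale a (cubic_scale b x) = cubic_scale (a * b) x"
    by transfer (simp add: cubic_rel_def mult_map_scale_conv_mult cubic_ideal_zero
        mult_single flip: mult.assoc)
  show "cubic_scale 1 x = x"
    by transfer (simp add: cubic_rel_def mult_map_scale_conv_mult cubic_ideal_zero)
qed

lemma single_zero_central:
  fixes f :: "'k::comm_ring_1 free_alg"
  shows "Poly_Mapping.single 0 c * f = f * Poly_Mapping.single 0 c"
proof (rule poly_mapping_eqI)
  fix w
  have "Sum_any (\<lambda>q. Poly_Mapping.lookup (Poly_Mapping.single 0 c) q when w = l + q) = (c when w = l)"
    for l :: gen_word
  proof -
    have "(\<lambda>q. Poly_Mapping.lookup (Poly_Mapping.single 0 c) q when w = l + q) =
          (\<lambda>q. (c when w = l) when q = 0)"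
      by (rule ext) (auto simp: lookup_single when_def)
    then show ?thesis by (simp only: Sum_any_when_equal)
  qed
  then have "Poly_Mapping.lookup (f * Poly_Mapping.single 0 c) w = Poly_Mapping.lookup f w * c"
    by (simp add: lookup_mult mult_when)
  moreover have "Poly_Mapping.lookup (Poly_Mapping.single 0 c * f) w = c * Poly_Mapping.lookup f w"
    by (simp add: map.rep_eq when_def flip: mult_map_scale_conv_mult)
  ultimately show "Poly_Mapping.lookup (Poly_Mapping.single 0 c * f) w =
      Poly_Mapping.lookup (f * Poly_Mapping.single 0 c) w"
    by (simp add: mult.commute)
qed

lemma cubic_scale_mult:
  fixes x y :: "'k::comm_ring_1 cubic_alg"
  shows cubic_scale_mult_left: "cubic_scale c x * y = cubic_scale c (x * y)"
    and cubic_scale_mult_right: "x * cubic_scale c y = cubic_scale c (x * y)"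
  subgoal by transfer
    (simp add: cubic_rel_def mult_map_scale_conv_mult cubic_ideal_zero mult.assoc)
  subgoal by transfer
    (metis cubic_ideal_zero cubic_rel_def diff_self mult.assoc mult_map_scale_conv_mult
      single_zero_central)
  done

lift_definition s1 :: "'k::comm_ring_1 cubic_alg" is X1 .

lift_definition s2 :: "'k::comm_ring_1 cubic_alg" is X2 .

lemma cubic_alg_relations:
  shows "s1 * s2 * s1 = s2 * s1 * (s2 :: 'k::comm_ring_1 cubic_alg)"
    and "s1 ^ 3 = (0 :: 'k cubic_alg)"
    and "s2 ^ 3 = (0 :: 'k cubic_alg)"
  using generated_ideal_superset[of "cubic_relators :: 'k free_alg set"]
  unfolding power3_eq_cube
  by (transfer; simp add: cubic_rel_def cubic_ideal_def cubic_relators_def power3_eq_cube)+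

end

theory Submission
  imports Defs
begin

text \<open>
  Each of the four words \<open>S1 S2 S1\<close>, \<open>S2 S1 S2\<close>, \<open>S1 S1 S1\<close>, \<open>S2 S2 S2\<close> that occur in the
  relations has equal letters at distance two, and these are all the words of length three
  with that property. Factoring out all four words gives a quotient of the algebra that is a
  monomial algebra: it has as a basis the words in which letters at distance two always differ,
  here called alternating.
  There are alternating words of every length, namely the prefixes of
  \<open>S1 S1 S2 S2 S1 S1 S2 S2 \<dots>\<close>.

  The proof works with the coordinate functionals of this quotient instead of the quotient
  itself. The coefficient of an alternating word vanishes on the cubic ideal (lemma
  \<open>cubic_ideal_alternating\<close>), so it is a well-defined linear functional on the presented algebra
  (\<open>coeff\<close>). Any element has only finitely many nonzero coefficients, so the span of finitely
  many elements involves only finitely many alternating words. But an alternating word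
  itself has coefficient \<open>1 \<noteq> 0\<close> at that word, and there are infinitely many of them.
\<close>

section \<open>Alternating words\<close>

definition alternating :: "gen_word \<Rightarrow> bool" where
  "alternating w \<longleftrightarrow> (\<forall>i. i + 2 < length (letters w) \<longrightarrow> letters w ! i \<noteq> letters w ! (i + 2))"

lemma alternating_plusD:
  assumes "alternating (u + v)"
  shows "alternating u" and "alternating v"
proof -
  have differ: "(letters u @ letters v) ! i \<noteq> (letters u @ letters v) ! (i + 2)"
    if "i + 2 < length (letters u) + length (letters v)" for i
    using assms that by (auto simp: alternating_def plus_gen_word_def)
  show "alternating u"
    unfolding alternating_def
  proof (intro allI impI)
    fix i assume "i + 2 < length (letters u)"
    then show "letters u ! i \<noteq> letters u ! (i + 2)"
      using differ[of i] by (simp add: nth_append)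
  qed
  show "alternating v"
    unfolding alternating_def
  proof (intro allI impI)
    fix i assume "i + 2 < length (letters v)"
    then show "letters v ! i \<noteq> letters v ! (i + 2)"
      using differ[of "length (letters u) + i"] by (simp add: nth_append)
  qed
qed

lemma infinite_alternating: "infinite {w. alternating w}"
proof -
  define p where "p n = Word (map (\<lambda>i. if i mod 4 < 2 then S1 else S2) [0..<n])" for n :: nat
  have "alternating (p n)" for n
  proof -
    have "i mod 4 < 2 \<longleftrightarrow> \<not> (i + 2) mod 4 < 2" for i :: nat
      by presburger
    then have "(if i mod 4 < 2 then S1 else S2) \<noteq> (if (i + 2) mod 4 < 2 then S1 else S2)"
      for i :: nat
      by (metis gen.distinct(1))
    then show ?thesis
      by (simp only: alternating_def p_def gen_word.sel length_map length_upt) simp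
  qed
  then have range: "range p \<subseteq> {w. alternating w}"
    by blast
  have "inj p"
  proof (rule injI)
    fix m n assume "p m = p n"
    then have "length (letters (p m)) = length (letters (p n))"
      by simp
    then show "m = n"
      by (simp add: p_def)
  qed
  then have "infinite (range p)"
    by (simp add: finite_image_iff)
  with range show ?thesis
    by (rule infinite_super)
qed


section \<open>Coefficients of alternating words on the presented algebra\<close>

text \<open>
  A factorisation of an alternating word has alternating factors. Hence, if one of \<open>f\<close> and \<open>g\<close>
  has no alternating word in its support, then no term of the convolution product \<open>f * g\<close>
  contributes to an alternating word.
\<close>

lemma two_sided_ideal_no_alternating:
  "two_sided_ideal {f :: 'k::comm_ring_1 free_alg.
      \<forall>w. alternating w \<longrightarrow> Poly_Mapping.lookup f w = 0}"
    (is "two_sided_ideal ?I")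
proof -
  have left: "Poly_Mapping.lookup (r * f) w = 0"
    if f: "f \<in> ?I" and w: "alternating w" for r f :: "'k free_alg" and w
  proof -
    have "(Poly_Mapping.lookup f q when w = l + q) = 0" for l q
      using f w alternating_plusD(2)[of l q] by (cases "w = l + q") simp_all
    then show ?thesis
      by (simp add: lookup_mult)
  qed
  have right: "Poly_Mapping.lookup (f * r) w = 0"
    if f: "f \<in> ?I" and w: "alternating w" for r f :: "'k free_alg" and w
  proof -
    have "Poly_Mapping.lookup f l * Sum_any (\<lambda>q. Poly_Mapping.lookup r q when w = l + q) = 0"
      for l
    proof (cases "alternating l")
      case True
      then show ?thesis using f by simp
    next
      case False
      then have "w \<noteq> l + q" for q
        using w alternating_plusD(1)[of l q] by blast
      then show ?thesis by simp
    qed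
    then show ?thesis
      by (simp add: lookup_mult)
  qed
  show ?thesis
    unfolding two_sided_ideal_def using left right by (auto simp: lookup_add)
qed

lemma cubic_ideal_alternating:
  assumes "(f :: 'k::comm_ring_1 free_alg) \<in> cubic_ideal" and "alternating w"
  shows "Poly_Mapping.lookup f w = 0"
proof -
  let ?I = "{f :: 'k free_alg. \<forall>w. alternating w \<longrightarrow> Poly_Mapping.lookup f w = 0}"
  have word: "Poly_Mapping.lookup (Poly_Mapping.single (Word [x, y, x]) (1 :: 'k)) v = 0"
    if "alternating v" for x y v
    using that by (auto simp: lookup_single alternating_def when_def)
  have "cubic_relators \<subseteq> ?I"
    by (simp add: cubic_relators_def X1_def X2_def power3_eq_cube mult_single plus_gen_word_def
        lookup_minus word)
  then have "cubic_ideal \<subseteq> ?I"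
    unfolding cubic_ideal_def by (rule generated_ideal_minimal[OF two_sided_ideal_no_alternating])
  then show ?thesis
    using assms by blast
qed

text \<open>
  At words that are not alternating the coefficient depends on the representative, so there the
  functional is set to \<open>0\<close>.
\<close>

lift_definition coeff :: "gen_word \<Rightarrow> 'k::comm_ring_1 cubic_alg \<Rightarrow> 'k"
  is "\<lambda>w f. if alternating w then Poly_Mapping.lookup f w else 0"
  using cubic_ideal_alternating by (fastforce simp: cubic_rel_def lookup_minus)

lemma coeff_zero: "coeff w 0 = 0"
  by transfer simp

lemma coeff_add: "coeff w (x + y) = coeff w x + coeff w y"
  by transfer (simp add: lookup_add)

lemma coeff_scale: "coeff w (cubic_scale c x) = c * coeff w x"
  by transfer (simp add: map.rep_eq when_def)

lemma finite_coeff_support: "finite {w. coeff w x \<noteq> 0}"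
proof transfer
  fix f :: "'a free_alg"
  have "{w. (if alternating w then Poly_Mapping.lookup f w else 0) \<noteq> 0} \<subseteq> Poly_Mapping.keys f"
    by (auto simp: in_keys_iff)
  then show "finite {w. (if alternating w then Poly_Mapping.lookup f w else 0) \<noteq> 0}"
    by (rule finite_subset) simp
qed

lemma coeff_word_exists:
  assumes "alternating w"
  obtains x :: "'k::comm_ring_1 cubic_alg" where "coeff w x = 1"
proof -
  have "\<exists>x :: 'k cubic_alg. coeff w x = 1"
    using assms by transfer (metis lookup_single_eq)
  then show ?thesis
    using that by blast
qed

lemma coeff_span_eq_zero:
  fixes B :: "'k::comm_ring_1 cubic_alg set"
  assumes "x \<in> module.span cubic_scale B" and "\<And>b. b \<in> B \<Longrightarrow> coeff w b = 0"
  shows "coeff w x = 0"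
proof -
  interpret module "cubic_scale :: 'k \<Rightarrow> 'k cubic_alg \<Rightarrow> 'k cubic_alg"
    by (rule module_cubic_scale)
  have "subspace {y :: 'k cubic_alg. coeff w y = 0}"
    by (simp add: subspace_def coeff_zero coeff_add coeff_scale)
  then have "span B \<subseteq> {y. coeff w y = 0}"
    using assms(2) by (intro span_minimal) auto
  then show ?thesis
    using assms(1) by blast
qed


section \<open>Infinite generation\<close>

theorem proposition3p2:
  shows "\<not> (\<exists>B :: 'k::comm_ring_1 cubic_alg set.
            finite B \<and> module.span (cubic_scale :: 'k \<Rightarrow> 'k cubic_alg \<Rightarrow> 'k cubic_alg) B = UNIV)"
proof
  assume "\<exists>B :: 'k cubic_alg set. finite B \<and> module.span cubic_scale B = UNIV"
  then obtain B :: "'k cubic_alg set"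
    where "finite B" and span: "module.span cubic_scale B = UNIV"
    by blast
  then have "finite (\<Union>b\<in>B. {w. coeff w b \<noteq> 0})"
    by (simp add: finite_coeff_support)
  then have "\<not> {w. alternating w} \<subseteq> (\<Union>b\<in>B. {w. coeff w b \<noteq> 0})"
    using infinite_alternating finite_subset by blast
  then obtain w where w: "alternating w" and vanish: "\<And>b. b \<in> B \<Longrightarrow> coeff w b = 0"
    by blast
  obtain x :: "'k cubic_alg" where "coeff w x = 1"
    using w by (rule coeff_word_exists)
  moreover have "coeff w x = 0"
    using vanish by (intro coeff_span_eq_zero[of x B]) (simp_all add: span)
  ultimately show False
    by simp
qed

end
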